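(* Let $K$ be a finite field with $q$ elements such that $-1$ is not a square in $K$. Let $q + 1 = 2^a l$ with $l$ odd and $a \geq 1$, and let $n = 2^{\alpha} k$ with $k$ odd and $\alpha \geq 2$. Suppose $L$ is a cyclic extension of $K$ of degree $n$ with $\mathrm{Gal}(L/K) = \langle \sigma_f \rangle$, where $\sigma_f$ is the Frobenius map of $L$ defined by $\sigma_f : b \mapsto b^q$. Let $A^1 = A^{\sigma_f}$. (1) If $\alpha \leq a+1$, then there are $K$-subspaces of $A^1$ such that $$A^1 = \mathcal{V}_1 \oplus \mathcal{V}_2 \oplus \mathcal{E}_1 \oplus \cdots \oplus \mathcal{E}_{\alpha - 1},$$ where (i) $\mathcal{E}_i$ is an $n$-subspace of dimension $n/2^i$ for $1 \leq i \leq \alpha - 1$; (ii) $\mathcal{V}_j$ is an $(n-2)$-subspace of dimension $k$ for $1 \leq j \leq 2$. (2) If $\alpha > a+1$ and $l = 1$, that is, $q = 2^a - 1$, then there are $K$-subspaces of $A^1$ such that $$A^1 = \mathcal{V}_1 \oplus \mathcal{V}_2 \oplus \mathcal{E}_1 \oplus \cdots \oplus \mathcal{E}_{\alpha - 1},$$ where (i) $\mathcal{E}_i$ is an $n$-subspace of dimension $n/2^i$ for $1 \leq i \leq a$ and an $(n-2)$-subspace of dimension $n/2^i$ for $a+1 \leq i \leq \alpha - 1$; (ii) $\mathcal{V}_j$ is an $(n-2)$-subspace of dimension $k$ for $1 \leq j \leq 2$.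
   Context: For a finite Galois extension $L/K$, $\mathrm{Alt}_K(L)$ denotes the $K$-space of alternating $K$-bilinear forms (skew-forms) $L \times L \to K$, and $\mathrm{Tr}^L_K(a) = \sum_{\theta \in \mathrm{Gal}(L/K)} \theta(a)$. For $\tau \in \mathrm{Gal}(L/K)$ and $b \in L$ define the skew-form $f_{b,\tau}(x,y) = \mathrm{Tr}^L_K\big(b(x\tau(y) - \tau(x)y)\big)$ for $x,y \in L$, and the subspace $A^{\tau} = \{ f_{b,\tau} : b \in L\}$ of $\mathrm{Alt}_K(L)$. An $r$-subspace of $\mathrm{Alt}_K(L)$ is a $K$-subspace all of whose nonzero skew-forms have rank $r$. Dimensions are over $K$. *)

theory Defs
  imports
    Complex_Main
    "HOL-Library.Cardinality"
    "HOL-Library.Function_Algebras"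
    "HOL-Algebra.Generated_Groups"
begin

text \<open>
  A field extension \<open>L/K\<close> is given by field types \<open>'k\<close>, \<open>'l\<close> and an embedding
  \<open>\<phi> :: 'k \<Rightarrow> 'l\<close>; the image \<open>range \<phi>\<close> is the copy of \<open>K\<close> inside \<open>L\<close>.
  Linear algebra over \<open>K\<close> is that of the locale \<^locale>\<open>vector_space\<close>, with scalar
  multiplication as an explicit argument.
\<close>

definition field_embedding :: "('k::field \<Rightarrow> 'l::field) \<Rightarrow> bool" where
  "field_embedding \<phi> \<longleftrightarrow>
     \<phi> 1 = 1 \<and> (\<forall>x y. \<phi> (x + y) = \<phi> x + \<phi> y) \<and> (\<forall>x y. \<phi> (x * y) = \<phi> x * \<phi> y)"

definition ext_scale :: "('k::field \<Rightarrow> 'l::field) \<Rightarrow> 'k \<Rightarrow> 'l \<Rightarrow> 'l" where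
  "ext_scale \<phi> c x = \<phi> c * x"

lemma field_embedding_inj:
  assumes "field_embedding \<phi>"
  shows "inj \<phi>"
proof (rule injI)
  fix x y assume eq: "\<phi> x = \<phi> y"
  have "\<phi> y + \<phi> (x - y) = \<phi> y"
    using assms eq unfolding field_embedding_def by (metis add.commute diff_add_cancel)
  then have z: "\<phi> (x - y) = 0" by simp
  show "x = y"
  proof (rule ccontr)
    assume "x \<noteq> y"
    then have "(x - y) * inverse (x - y) = 1" by simp
    then have "\<phi> (x - y) * \<phi> (inverse (x - y)) = 1"
      using assms unfolding field_embedding_def by metis
    with z show False by simp
  qed
qed

lemma vector_space_ext_scale: "field_embedding \<phi> \<Longrightarrow> vector_space (ext_scale \<phi>)"
  by unfold_locales (simp_all add: ext_scale_def field_embedding_def algebra_simps)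

definition galois_set :: "('k::field \<Rightarrow> 'l::field) \<Rightarrow> ('l \<Rightarrow> 'l) set" where
  "galois_set \<phi> = {\<theta>. bij \<theta> \<and> field_embedding \<theta> \<and> (\<forall>c. \<theta> (\<phi> c) = \<phi> c)}"

definition galois_group :: "('k::field \<Rightarrow> 'l::field) \<Rightarrow> ('l \<Rightarrow> 'l) monoid" where
  "galois_group \<phi> = \<lparr>carrier = galois_set \<phi>, mult = (\<circ>), one = id\<rparr>"

definition finite_galois_extension :: "('k::field \<Rightarrow> 'l::field) \<Rightarrow> bool" where
  "finite_galois_extension \<phi> \<longleftrightarrow>
     field_embedding \<phi> \<and>
     (\<exists>B. finite_dimensional_vector_space (ext_scale \<phi>) B) \<and>
     {x. \<forall>\<theta>\<in>galois_set \<phi>. \<theta> x = x} = range \<phi>"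

definition ext_degree :: "('k::field \<Rightarrow> 'l::field) \<Rightarrow> nat" where
  "ext_degree \<phi> = vector_space.dim (ext_scale \<phi>) UNIV"

text \<open>
  For a Galois extension the sum lies in \<open>range \<phi>\<close>, and it is pulled back to \<open>'k\<close>.
\<close>

definition galois_trace :: "('k::field \<Rightarrow> 'l::field) \<Rightarrow> 'l \<Rightarrow> 'k" where
  "galois_trace \<phi> a = inv_into UNIV \<phi> (\<Sum>\<theta>\<in>galois_set \<phi>. \<theta> a)"

definition form_scale :: "'k::field \<Rightarrow> ('l \<Rightarrow> 'l \<Rightarrow> 'k) \<Rightarrow> ('l \<Rightarrow> 'l \<Rightarrow> 'k)" where
  "form_scale c f = (\<lambda>x y. c * f x y)"

lemma vector_space_form_scale:
  "vector_space (form_scale :: 'k::field \<Rightarrow> ('l \<Rightarrow> 'l \<Rightarrow> 'k) \<Rightarrow> ('l \<Rightarrow> 'l \<Rightarrow> 'k))"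
  by unfold_locales (simp_all add: form_scale_def fun_eq_iff algebra_simps)

definition Alt :: "('k::field \<Rightarrow> 'l::field) \<Rightarrow> ('l \<Rightarrow> 'l \<Rightarrow> 'k) set" where
  "Alt \<phi> = {f. (\<forall>x. Vector_Spaces.linear (ext_scale \<phi>) (*) (\<lambda>y. f x y)) \<and>
               (\<forall>y. Vector_Spaces.linear (ext_scale \<phi>) (*) (\<lambda>x. f x y)) \<and>
               (\<forall>x. f x x = 0)}"

definition form_radical :: "('l \<Rightarrow> 'l \<Rightarrow> 'k::field) \<Rightarrow> 'l set" where
  "form_radical f = {x. \<forall>y. f x y = 0}"

definition form_rank :: "('k::field \<Rightarrow> 'l::field) \<Rightarrow> ('l \<Rightarrow> 'l \<Rightarrow> 'k) \<Rightarrow> nat" where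
  "form_rank \<phi> f = ext_degree \<phi> - vector_space.dim (ext_scale \<phi>) (form_radical f)"

definition rank_subspace ::
  "('k::field \<Rightarrow> 'l::field) \<Rightarrow> nat \<Rightarrow> ('l \<Rightarrow> 'l \<Rightarrow> 'k) set \<Rightarrow> bool" where
  "rank_subspace \<phi> r W \<longleftrightarrow>
     module.subspace form_scale W \<and> W \<subseteq> Alt \<phi> \<and> (\<forall>f\<in>W. f \<noteq> 0 \<longrightarrow> form_rank \<phi> f = r)"

abbreviation form_dim :: "('l \<Rightarrow> 'l \<Rightarrow> 'k::field) set \<Rightarrow> nat" where
  "form_dim \<equiv> vector_space.dim form_scale"

definition skew_form :: "('k::field \<Rightarrow> 'l::field) \<Rightarrow> 'l \<Rightarrow> ('l \<Rightarrow> 'l) \<Rightarrow> 'l \<Rightarrow> 'l \<Rightarrow> 'k" where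
  "skew_form \<phi> b \<tau> = (\<lambda>x y. galois_trace \<phi> (b * (x * \<tau> y - \<tau> x * y)))"

definition skew_form_space ::
  "('k::field \<Rightarrow> 'l::field) \<Rightarrow> ('l \<Rightarrow> 'l) \<Rightarrow> ('l \<Rightarrow> 'l \<Rightarrow> 'k) set" where
  "skew_form_space \<phi> \<tau> = {skew_form \<phi> b \<tau> | b. True}"

definition direct_sum ::
  "('k::field \<Rightarrow> 'v::ab_group_add \<Rightarrow> 'v) \<Rightarrow> 'i set \<Rightarrow> ('i \<Rightarrow> 'v set) \<Rightarrow> 'v set \<Rightarrow> bool" where
  "direct_sum scale I W A \<longleftrightarrow>
     finite I \<and>
     (\<forall>i\<in>I. module.subspace scale (W i) \<and> W i \<subseteq> A) \<and>
     A = {\<Sum>i\<in>I. w i | w. \<forall>i\<in>I. w i \<in> W i} \<and>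
     (\<forall>w. (\<forall>i\<in>I. w i \<in> W i) \<and> (\<Sum>i\<in>I. w i) = 0 \<longrightarrow> (\<forall>i\<in>I. w i = 0))"

definition frobenius :: "('k::{field,finite} \<Rightarrow> 'l::field) \<Rightarrow> 'l \<Rightarrow> 'l" where
  "frobenius \<phi> = (\<lambda>b. b ^ CARD('k))"

end

theory Submission
  imports Defs "HOL-Computational_Algebra.Polynomial"
begin

text \<open>
  Write \<open>L\<close> for the extension and \<open>\<sigma>(x) = x ^ q\<close>. Since the trace is \<open>\<sigma>\<close>-invariant and
  nondegenerate, the radical of the form \<open>f\<^sub>b\<close> attached to \<open>b \<noteq> 0\<close> is the set of \<open>x\<close> with
  \<open>b x = b ^ q x ^ (q ^ 2)\<close>, that is \<open>\<sigma>\<^sup>2(x) = (b / b ^ q) x\<close>. Such an equation \<open>\<sigma>\<^sup>m(x) = \<epsilon> x\<close>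
  has either only the zero solution or a solution set of dimension \<open>m\<close> (when \<open>q ^ m - 1\<close>
  divides \<open>q ^ n - 1\<close>), and the cyclic structure of the group of units decides between the two by
  whether a power of \<open>\<epsilon>\<close> is \<open>1\<close> (\<open>card_twisted_fixed\<close>). For the radical this says: with
  \<open>D = (q ^ n - 1) / (q + 1)\<close>, the form \<open>f\<^sub>b\<close> has rank \<open>n - 2\<close> if \<open>b ^ D = 1\<close>, which means that
  \<open>b\<close> is a power of exponent \<open>q + 1\<close>, and rank \<open>n\<close> otherwise (\<open>form_rank_eq\<close>).
  Moreover \<open>b \<mapsto> f\<^sub>b\<close> is a linear isomorphism of \<open>L\<close> onto \<open>A\<^sup>1\<close> (\<open>inj_form\<close>), so the theorem
  becomes a statement about subspaces of \<open>L\<close> and the powers of exponent \<open>q + 1\<close> in them.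

  Put \<open>m\<^sub>i = n / 2 ^ i\<close>. The map \<open>\<sigma>\<close> to the power \<open>m\<^sub>i\<close> is an involution of the subfield
  with \<open>q\<close> to the power \<open>2 m\<^sub>i\<close> elements, and as the characteristic is odd this subfield is the
  direct sum of the eigenspaces for \<open>1\<close> and \<open>-1\<close> (\<open>twisted_fixed_split\<close>,
  \<open>twisted_fixed_disjoint\<close>). The first eigenspace is the next subfield; the second gives
  \<open>\<E>\<^sub>i\<close>. At the bottom of the tower, where \<open>m\<^sub>i = k\<close> is odd, the two eigenspaces give
  \<open>\<V>\<^sub>1\<close> and \<open>\<V>\<^sub>2\<close>. Every dimension is found by counting elements.

  It remains to evaluate \<open>b ^ D\<close> on an eigenspace, where \<open>b\<close> raised to \<open>M = q ^ m - 1\<close>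
  is \<open>1\<close> or \<open>-1\<close>, with \<open>m = m\<^sub>i\<close>. For even \<open>m\<close> each step of the tower contributes exactly
  one factor \<open>2\<close>, because \<open>q ^ m + 1\<close> is twice an odd number; hence \<open>q ^ n - 1 = 2 ^ i u M\<close>
  with \<open>u\<close> odd (\<open>two_adic_power_minus_one\<close>). If \<open>i \<le> a\<close>, then \<open>u M\<close> is a multiple of \<open>D\<close> and
  \<open>b\<close> to the power \<open>u M\<close> is \<open>-1\<close>, so \<open>b ^ D \<noteq> 1\<close> (\<open>anti_fixed_not_power\<close>). If \<open>i > a\<close>
  and \<open>q + 1 = 2 ^ a\<close>, then \<open>D\<close> is an even multiple of \<open>M\<close>, so \<open>b ^ D = 1\<close>
  (\<open>anti_fixed_power\<close>). For \<open>m = k\<close> odd, \<open>q + 1\<close> divides \<open>q ^ k + 1\<close>, and again \<open>D\<close> is an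
  even multiple of \<open>M\<close> (\<open>odd_twisted_fixed_power\<close>).
\<close>

section \<open>Vector spaces over a finite field\<close>

text \<open>
  Coordinates with respect to a basis. All dimensions below are read off from cardinalities in
  this way, so that no bases of subfields or of spaces of forms need be exhibited.
\<close>
lemma finite_field_vector_space_card:
  fixes scale :: "'k::{field,finite} \<Rightarrow> 'v::ab_group_add \<Rightarrow> 'v"
  assumes "vector_space scale" and "module.subspace scale S" and "finite S"
  shows "card S = CARD('k) ^ vector_space.dim scale S"
proof -
  interpret vector_space scale by fact
  obtain B where B: "B \<subseteq> S" "independent B" "S \<subseteq> span B" "card B = dim S"
    using basis_exists by blast
  have fB: "finite B" using B(1) \<open>finite S\<close> finite_subset by blast
  have spanB: "span B = S" using B(1,3) assms(2) span_minimal by blast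
  define comb where "comb u = (\<Sum>b\<in>B. scale (u b) b)" for u
  have "inj_on comb (B \<rightarrow>\<^sub>E UNIV)"
  proof (rule inj_onI)
    fix u v assume uv: "u \<in> B \<rightarrow>\<^sub>E UNIV" "v \<in> B \<rightarrow>\<^sub>E UNIV" and "comb u = comb v"
    then have "(\<Sum>b\<in>B. scale (u b - v b) b) = 0"
      by (simp add: comb_def scale_left_diff_distrib sum_subtractf)
    then have "\<forall>b\<in>B. u b - v b = 0"
      using B(2) fB independent_explicit_finite_subsets
      by (meson independentD order_refl)
    then show "u = v" using uv by (intro PiE_ext[of u B _ v]) auto
  qed
  moreover have "comb ` (B \<rightarrow>\<^sub>E UNIV) = span B"
  proof -
    have "comb u = comb (restrict u B)" for u unfolding comb_def by (rule sum.cong) auto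
    then have "range comb = comb ` (B \<rightarrow>\<^sub>E UNIV)"
      by (auto simp: image_iff) (metis restrict_PiE_iff UNIV_I)
    then show ?thesis unfolding span_finite[OF fB] comb_def by simp
  qed
  ultimately have "card S = card (B \<rightarrow>\<^sub>E (UNIV :: 'k set))"
    using spanB card_image by metis
  then show ?thesis using B(4) fB by (simp add: card_PiE)
qed

lemma dim_of_card:
  fixes scale :: "'k::{field,finite} \<Rightarrow> 'v::ab_group_add \<Rightarrow> 'v"
  assumes "vector_space scale" and "module.subspace scale S" and "card S = CARD('k) ^ d"
  shows "vector_space.dim scale S = d"
proof -
  have two: "2 \<le> CARD('k)"
  proof -
    have "card {0, 1::'k} \<le> CARD('k)" by (rule card_mono) auto
    then show ?thesis by simp
  qed
  then have "card S > 0" using assms(3) by simp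
  then have "CARD('k) ^ vector_space.dim scale S = CARD('k) ^ d"
    using finite_field_vector_space_card assms card_gt_0_iff by metis
  then show ?thesis using two by (simp add: power_inject_exp)
qed

lemma finite_of_finite_dimensional:
  fixes scale :: "'k::{field,finite} \<Rightarrow> 'v::ab_group_add \<Rightarrow> 'v"
  assumes "finite_dimensional_vector_space scale B"
  shows "finite (UNIV :: 'v set)"
proof -
  interpret finite_dimensional_vector_space scale B by fact
  define comb where "comb u = (\<Sum>b\<in>B. scale (u b) b)" for u
  have "comb u = comb (restrict u B)" for u unfolding comb_def by (rule sum.cong) auto
  then have "range comb \<subseteq> comb ` (B \<rightarrow>\<^sub>E UNIV)"
    by (auto simp: image_iff) (metis restrict_PiE_iff UNIV_I)
  moreover have "range comb = UNIV"
    using span_Basis unfolding span_finite[OF finite_Basis] comb_def .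
  moreover have "finite (B \<rightarrow>\<^sub>E (UNIV :: 'k set))" using finite_Basis by (simp add: finite_PiE)
  ultimately show ?thesis by (metis finite_imageI finite_subset)
qed

section \<open>Roots of unity in a finite field\<close>

lemma card_power_eq_le:
  fixes c :: "'a::field"
  assumes "d > 0"
  shows "finite {x. x ^ d = c}" and "card {x. x ^ d = c} \<le> d"
proof -
  define p where "p = monom 1 d - [:c:]"
  have deg: "degree p = d" unfolding p_def using assms
    by (subst diff_conv_add_uminus, subst degree_add_eq_left) (simp_all add: degree_monom_eq)
  then have "p \<noteq> 0" using assms by force
  moreover have "{x. x ^ d = c} = {x. poly p x = 0}" by (simp add: p_def poly_monom)
  ultimately show "finite {x. x ^ d = c}" "card {x. x ^ d = c} \<le> d"
    using poly_roots_finite[of p] card_poly_roots_bound[of p] deg by auto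
qed

text \<open>
  Multiplication by a unit permutes the units, so it does not change their product.
\<close>
lemma finite_field_unit_power:
  fixes x :: "'a::field"
  assumes "finite (UNIV :: 'a set)" and "x \<noteq> 0"
  shows "x ^ (CARD('a) - 1) = 1"
proof -
  have "(\<lambda>y. x * y) ` (- {0}) = - {0}"
  proof (intro equalityI subsetI)
    fix y assume "y \<in> - {0 :: 'a}"
    then have "y = x * (y / x)" "y / x \<in> - {0}" using assms(2) by auto
    then show "y \<in> (\<lambda>y. x * y) ` (- {0})" by blast
  qed (use assms(2) in auto)
  then have "(\<Prod>y\<in>-{0}. y) = (\<Prod>y\<in>-{0}. x * y)"
    using prod.reindex[of "\<lambda>y. x * y" "- {0}" id] assms(2)
    by (simp add: inj_on_def o_def)
  also have "\<dots> = x ^ card (- {0 :: 'a}) * (\<Prod>y\<in>-{0}. y)" by (simp add: prod.distrib)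
  finally have "(\<Prod>y\<in>-{0::'a}. y) = x ^ card (- {0 :: 'a}) * (\<Prod>y\<in>-{0}. y)" .
  moreover have "(\<Prod>y\<in>-{0::'a}. y) \<noteq> 0"
    using finite_subset[OF subset_UNIV assms(1)] by simp
  ultimately have "x ^ card (- {0 :: 'a}) = 1" by simp
  then show ?thesis by (simp only: Compl_eq_Diff_UNIV card_Diff_singleton[OF UNIV_I])
qed

text \<open>
  The form in which cyclicity of the group of units is needed: the kernel of one power map is the
  image of the complementary one. The fibres of \<open>x \<mapsto> x ^ e\<close> have at most \<open>e\<close> elements, so the
  image has at least \<open>d\<close>, while a polynomial of degree \<open>d\<close> has at most \<open>d\<close> roots.
\<close>
lemma finite_field_roots_of_unity:
  assumes fin: "finite (UNIV :: 'a::field set)" and de: "CARD('a) - 1 = d * e"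
  shows "card {x::'a. x ^ d = 1} = d"
    and "{x::'a. x ^ d = 1} = (\<lambda>x. x ^ e) ` (- {0})"
proof -
  have fin': "finite S" for S :: "'a set" using finite_subset[OF subset_UNIV fin] .
  have cU: "card (- {0 :: 'a}) = d * e" using de by (simp only: Compl_eq_Diff_UNIV card_Diff_singleton[OF UNIV_I])
  moreover have "card (- {0 :: 'a}) > 0" using fin' by (metis ComplI card_gt_0_iff empty_iff singletonD zero_neq_one)
  ultimately have pos: "d > 0" "e > 0" by auto
  let ?P = "(\<lambda>x. x ^ e) ` (- {0 :: 'a})"
  have sub: "?P \<subseteq> {x. x ^ d = 1}"
    using finite_field_unit_power[OF fin] de by (auto simp: power_mult[symmetric] mult.commute[of e d])
  have "- {0} \<subseteq> (\<Union>y\<in>?P. {x. x ^ e = y})" by auto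
  then have "d * e \<le> card (\<Union>y\<in>?P. {x. x ^ e = y})"
    unfolding cU[symmetric] using fin' by (intro card_mono)
  also have "\<dots> \<le> (\<Sum>y\<in>?P. card {x. x ^ e = y})" using fin' by (intro card_UN_le)
  also have "\<dots> \<le> card ?P * e"
    using sum_bounded_above[of ?P "\<lambda>y. card {x. x ^ e = y}" e, OF card_power_eq_le(2)[OF pos(2)]]
    by simp
  finally have "d \<le> card ?P" using pos(2) by simp
  moreover have "card ?P \<le> card {x :: 'a. x ^ d = 1}" using sub fin' by (intro card_mono)
  moreover have "card {x :: 'a. x ^ d = 1} \<le> d" using card_power_eq_le(2)[OF pos(1)] .
  ultimately show "card {x :: 'a. x ^ d = 1} = d" by simp
  with \<open>d \<le> card ?P\<close> sub show "{x. x ^ d = 1} = ?P" using fin' by (metis card_seteq)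
qed

section \<open>Divisibility of \<open>q ^ n - 1\<close>\<close>

lemma power_minus_one_dvd:
  fixes q :: nat
  assumes "m dvd n" and "q > 0"
  shows "q ^ m - 1 dvd q ^ n - 1"
proof -
  have "x - 1 dvd x ^ j - 1" if "x > 0" for x j :: nat
  proof (induction j)
    case (Suc j)
    have "x ^ Suc j - 1 = x * (x ^ j - 1) + (x - 1)"
      using that by (simp add: algebra_simps diff_mult_distrib2)
    then show ?case using Suc by (metis dvd_add dvd_mult dvd_refl)
  qed simp
  then show ?thesis using assms by (auto elim!: dvdE simp: power_mult)
qed

lemma power_double_minus_one:
  fixes q :: nat
  shows "q ^ (2 * m) - 1 = (q ^ m - 1) * (q ^ m + 1)"
  unfolding power_even_eq power2_eq_square by (simp add: algebra_simps)

text \<open>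
  Each doubling of an even exponent contributes a factor which is \<open>1\<close> plus the square of an odd
  number, hence exactly one new factor \<open>2\<close>.
\<close>
lemma two_adic_power_minus_one:
  fixes q :: nat
  assumes "odd q" and "even m"
  shows "\<exists>u. odd u \<and> q ^ (2 ^ j * m) - 1 = 2 ^ j * u * (q ^ m - 1)"
proof (induction j)
  case 0
  show ?case by (intro exI[of _ 1]) simp
next
  case (Suc j)
  then obtain u where u: "odd u" "q ^ (2 ^ j * m) - 1 = 2 ^ j * u * (q ^ m - 1)" by blast
  obtain h where h: "2 ^ j * m = 2 * h" using assms(2) by (metis dvd_mult dvdE)
  obtain s where s: "q ^ h = 2 * s + 1" using assms(1) by (metis even_power oddE)
  have v: "q ^ (2 ^ j * m) + 1 = 2 * (2 * (s ^ 2 + s) + 1)"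
    unfolding h power_even_eq s power2_eq_square by (simp add: algebra_simps)
  have "q ^ (2 ^ Suc j * m) - 1 = (q ^ (2 ^ j * m) - 1) * (q ^ (2 ^ j * m) + 1)"
    using power_double_minus_one[of q "2 ^ j * m"] by (simp only: power_Suc mult.assoc)
  also have "\<dots> = 2 ^ Suc j * (u * (2 * (s ^ 2 + s) + 1)) * (q ^ m - 1)"
    unfolding u(2) v by (simp only: power_Suc ac_simps)
  finally show ?case using u(1) by (intro exI[of _ "u * (2 * (s ^ 2 + s) + 1)"]) simp
qed

lemma Suc_base_dvd_square: "q + 1 dvd q ^ 2 - (1::nat)"
  using power_double_minus_one[of q 1] by (metis dvd_triv_right mult.right_neutral power_one_right)

text \<open>
  Modulo \<open>q + 1\<close> the base is \<open>-1\<close>; an identity that shows this is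
  \<open>q ^ (2 h + 1) + 1 = q (q ^ (2 h) - 1) + (q + 1)\<close>.
\<close>
lemma Suc_base_dvd_power_odd:
  fixes q :: nat
  assumes "odd k" and "q > 0"
  shows "q + 1 dvd q ^ k + 1"
proof -
  obtain h where k: "k = 2 * h + 1" using \<open>odd k\<close> by (rule oddE)
  have "q + 1 dvd q ^ (2 * h) - 1"
    using Suc_base_dvd_square power_minus_one_dvd[of 2 "2 * h" q] assms(2) by (auto intro: dvd_trans)
  then have "q + 1 dvd q * (q ^ (2 * h) - 1) + (q + 1)"
    by (intro dvd_add dvd_mult dvd_refl)
  moreover have "q * (q ^ (2 * h) - 1) + (q + 1) = q ^ k + 1"
  proof -
    have "q ^ (2 * h) \<ge> 1" using assms(2) by simp
    then have "q * (q ^ (2 * h) - 1) + q = q * q ^ (2 * h)"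
      by (simp add: diff_mult_distrib2)
    then show ?thesis by (simp add: k)
  qed
  ultimately show ?thesis by simp
qed

section \<open>Direct sums from a chain of subspaces\<close>

text \<open>
  If each member of a chain splits as the next member plus a complement, then the top is the direct
  sum of all complements and the bottom. The last complement and the bottom appear as the
  summands \<open>Inl 2\<close> and \<open>Inl 1\<close>, the other complements as \<open>Inr i\<close>. Existence and uniqueness
  of the decomposition both go by induction down the chain; in the uniqueness part the bottom
  summand and the last complement are merged into one element one level higher.
\<close>
lemma direct_sum_of_chain:
  fixes S T :: "nat \<Rightarrow> 'v::ab_group_add set" and r :: nat
  assumes vs: "vector_space scale" and r: "r \<ge> 1"
    and S: "\<And>i. i \<le> r \<Longrightarrow> module.subspace scale (S i)"
    and T: "\<And>i. i \<in> {1..r} \<Longrightarrow> module.subspace scale (T i)"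
    and split: "\<And>i. i < r \<Longrightarrow> S i = {x + y | x y. x \<in> S (Suc i) \<and> y \<in> T (Suc i)}"
    and indep: "\<And>i. i < r \<Longrightarrow> S (Suc i) \<inter> T (Suc i) \<subseteq> {0}"
  shows "direct_sum scale ({1..2} <+> {1..r - 1})
           (case_sum (\<lambda>j::nat. if j = 1 then S r else T r) T) (S 0)"
proof -
  interpret vector_space scale by fact
  define W where "W = case_sum (\<lambda>j::nat. if j = 1 then S r else T r) T"
  have step: "S (Suc i) \<subseteq> S i" "T (Suc i) \<subseteq> S i" if "i < r" for i
    unfolding split[OF that]
    using subspace_0[OF S[of "Suc i"]] subspace_0[OF T[of "Suc i"]] that
    by (force intro: exI[of _ 0])+
  have S0: "j \<le> r \<Longrightarrow> S j \<subseteq> S 0" for j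
  proof (induction j)
    case (Suc j)
    then show ?case using step(1)[of j] by auto
  qed simp
  have T0: "T j \<subseteq> S 0" if "j \<in> {1..r}" for j
  proof -
    obtain i where "j = Suc i" "i < r" using \<open>j \<in> {1..r}\<close> by (cases j) auto
    then show ?thesis using step(2)[of i] S0[of i] by auto
  qed
  have ex: "\<exists>w y. (\<forall>i\<in>{1..j}. w i \<in> T i) \<and> y \<in> S j \<and> x = y + (\<Sum>i=1..j. w i)"
    if "j \<le> r" "x \<in> S 0" for j x
    using that
  proof (induction j)
    case 0
    then show ?case by auto
  next
    case (Suc j)
    then obtain w y where w: "\<forall>i\<in>{1..j}. w i \<in> T i" "y \<in> S j" "x = y + (\<Sum>i=1..j. w i)"
      by auto
    then obtain y' t where y': "y = y' + t" "y' \<in> S (Suc j)" "t \<in> T (Suc j)"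
      using split[of j] Suc.prems by auto
    have "(\<Sum>i=1..j. (w(Suc j := t)) i) = (\<Sum>i=1..j. w i)" by (rule sum.cong) auto
    then have "x = y' + (\<Sum>i=1..Suc j. (w(Suc j := t)) i)"
      using w(3) y'(1) by (simp add: algebra_simps)
    then show ?case using w(1) y'(2,3)
      by (intro exI[of _ "w(Suc j := t)"] exI[of _ y']) auto
  qed
  have uniq: "y = 0 \<and> (\<forall>i\<in>{1..j}. w i = 0)"
    if "j \<le> r" "y \<in> S j" "\<forall>i\<in>{1..j}. w i \<in> T i" "y + (\<Sum>i=1..j. w i) = 0" for j y w
    using that
  proof (induction j arbitrary: y)
    case 0
    then show ?case by simp
  next
    case (Suc j)
    have "w (Suc j) \<in> T (Suc j)" using Suc.prems(3) by simp
    then have mem: "y + w (Suc j) \<in> S j" using split[of j] Suc.prems(1,2) by auto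
    have "y + w (Suc j) + (\<Sum>i=1..j. w i) = 0"
      using Suc.prems(4) by (simp add: algebra_simps)
    then have "y + w (Suc j) = 0 \<and> (\<forall>i\<in>{1..j}. w i = 0)"
      using Suc.prems(1,3) by (intro Suc.IH[OF _ mem]) simp_all
    then have *: "y + w (Suc j) = 0" "\<forall>i\<in>{1..j}. w i = 0" by blast+
    have "y = - w (Suc j)" using *(1) by (simp add: eq_neg_iff_add_eq_0)
    then have "y \<in> T (Suc j)" using subspace_neg[OF T[of "Suc j"]] Suc.prems by auto
    then have "y = 0" using indep[of j] Suc.prems by auto
    with * show ?case by (auto simp: atLeastAtMostSuc_conv)
  qed
  \<comment> \<open>The coordinate at \<open>Inl 2\<close> takes the place of the complement of index \<open>r\<close>.\<close>
  define w' where "w' w = (\<lambda>i. if i = r then w (Inl 2) else w (Inr i))"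
    for w :: "nat + nat \<Rightarrow> 'v"
  have sum_w: "(\<Sum>i\<in>{1..2} <+> {1..r - 1}. w i) = w (Inl 1) + (\<Sum>i=1..r. w' w i)" for w
  proof -
    have "(\<Sum>i=1..r. w' w i) = (\<Sum>i=1..r - 1. w' w i) + w (Inl 2)"
      using r by (cases r) (auto simp: w'_def)
    moreover have "(\<Sum>i=1..r - 1. w' w i) = (\<Sum>i=1..r - 1. w (Inr i))"
      using r by (intro sum.cong) (auto simp: w'_def)
    moreover have "{1..2::nat} = {1, 2}" by auto
    ultimately show ?thesis by (simp add: sum.Plus algebra_simps)
  qed
  have one_or_two: "j = Suc 0 \<or> j = 2" if "Suc 0 \<le> j" "j \<le> 2" for j using that by auto
  have mem_W: "(\<forall>i\<in>{1..2} <+> {1..r - 1}. w i \<in> W i) \<longleftrightarrow>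
      w (Inl 1) \<in> S r \<and> (\<forall>i\<in>{1..r}. w' w i \<in> T i)" (is "?L \<longleftrightarrow> ?R") for w
  proof
    assume L: ?L
    have "w (Inl 1) \<in> W (Inl 1)" "w (Inl 2) \<in> W (Inl 2)" using L by auto
    moreover have "w (Inr i) \<in> W (Inr i)" if "i \<in> {1..r - 1}" for i using L that by auto
    ultimately show ?R by (auto simp: W_def w'_def)
  next
    assume R: ?R
    have "w (Inl 2) \<in> T r" using R r by (force simp: w'_def)
    moreover have "w (Inr i) \<in> T i" if "i \<in> {1..r - 1}" for i
    proof -
      have "i \<in> {1..r}" "i \<noteq> r" using that r by auto
      then show ?thesis using bspec[OF conjunct2[OF R], of i] by (simp add: w'_def)
    qed
ultimately show ?L using R by (auto simp: W_def dest: one_or_two)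
  qed
  have "direct_sum scale ({1..2} <+> {1..r - 1}) W (S 0)"
    unfolding direct_sum_def
  proof (intro conjI allI impI)
    show "finite ({1..2::nat} <+> {1..r - 1})" by simp
    have "subspace (S r) \<and> S r \<subseteq> S 0" "subspace (T r) \<and> T r \<subseteq> S 0" using S T S0 T0 r by simp_all
    moreover have "subspace (T i) \<and> T i \<subseteq> S 0" if "i \<in> {1..r - 1}" for i
    proof -
      have "i \<in> {1..r}" using that by auto
      then show ?thesis using T T0 by blast
    qed
    ultimately show "\<forall>i\<in>{1..2} <+> {1..r - 1}. subspace (W i) \<and> W i \<subseteq> S 0"
      unfolding W_def by (intro ballI) (elim PlusE, simp_all)
    show "S 0 = {\<Sum>i\<in>{1..2} <+> {1..r - 1}. w i |w. \<forall>i\<in>{1..2} <+> {1..r - 1}. w i \<in> W i}"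
    proof (intro equalityI subsetI)
      fix x assume "x \<in> S 0"
      then obtain w y where w: "\<forall>i\<in>{1..r}. w i \<in> T i" "y \<in> S r" "x = y + (\<Sum>i=1..r. w i)"
        using ex[of r x] by auto
      define v where "v = case_sum (\<lambda>j::nat. if j = 1 then y else w r) w"
      have "w' v = w" by (auto simp: v_def w'_def)
      then have "x = (\<Sum>i\<in>{1..2} <+> {1..r - 1}. v i)" "\<forall>i\<in>{1..2} <+> {1..r - 1}. v i \<in> W i"
        unfolding sum_w mem_W using w by (simp_all add: v_def)
      then show "x \<in> {\<Sum>i\<in>{1..2} <+> {1..r - 1}. w i |w.
          \<forall>i\<in>{1..2} <+> {1..r - 1}. w i \<in> W i}" by blast
    next
      fix x assume "x \<in> {\<Sum>i\<in>{1..2} <+> {1..r - 1}. w i |w.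
          \<forall>i\<in>{1..2} <+> {1..r - 1}. w i \<in> W i}"
      then obtain v where "x = v (Inl 1) + (\<Sum>i=1..r. w' v i)"
          "v (Inl 1) \<in> S r" "\<forall>i\<in>{1..r}. w' v i \<in> T i"
        unfolding mem_W sum_w by blast
      moreover have "(\<Sum>i=1..r. w' v i) \<in> S 0"
        by (rule subspace_sum[OF S[OF le0]]) (use calculation(3) T0 in blast)
      ultimately show "x \<in> S 0" using S0[of r] subspace_add[OF S[of 0]] by auto
    qed
  next
    fix w assume "(\<forall>i\<in>{1..2} <+> {1..r - 1}. w i \<in> W i) \<and>
      (\<Sum>i\<in>{1..2} <+> {1..r - 1}. w i) = 0"
    then have "w (Inl 1) = 0 \<and> (\<forall>i\<in>{1..r}. w' w i = 0)"
      unfolding mem_W sum_w using uniq[of r "w (Inl 1)" "w' w"] by simp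
    moreover from this have "w (Inl 2) = 0" using r by (force simp: w'_def)
    moreover have "w (Inr i) = 0" if "i \<in> {1..r - 1}" for i
    proof -
      have "i \<in> {1..r}" "i \<noteq> r" using that r by auto
      then show ?thesis using bspec[OF conjunct2[OF calculation(1)], of i] by (simp add: w'_def)
    qed
    ultimately show "\<forall>i\<in>{1..2} <+> {1..r - 1}. w i = 0" by (auto dest: one_or_two)
  qed
  then show ?thesis by (simp add: W_def)
qed

section \<open>The trace of a finite extension generated by its Frobenius map\<close>

text \<open>
  That the Galois group is generated by the Frobenius map serves twice: it puts the Frobenius map
  itself into the Galois group, so that it is additive, bijective and fixes the base field, and it
  makes every automorphism a polynomial function of degree less than the order of the extension.
\<close>
locale frobenius_extension =
  fixes \<phi> :: "'k::{field,finite} \<Rightarrow> 'l::field" and q n :: nat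
  assumes galois: "finite_galois_extension \<phi>"
    and degree: "ext_degree \<phi> = n"
    and generated: "carrier (galois_group \<phi>) = generate (galois_group \<phi>) {frobenius \<phi>}"
    and card_base: "q = CARD('k)"
begin

abbreviation form :: "'l \<Rightarrow> 'l \<Rightarrow> 'l \<Rightarrow> 'k" where
  "form b \<equiv> skew_form \<phi> b (frobenius \<phi>)"

lemma embedding: "field_embedding \<phi>"
  using galois by (simp add: finite_galois_extension_def)

lemma embedding_simps:
  "\<phi> 1 = 1" "\<phi> (x + y) = \<phi> x + \<phi> y" "\<phi> (x * y) = \<phi> x * \<phi> y" "\<phi> 0 = 0"
  "\<phi> (x - y) = \<phi> x - \<phi> y" "\<phi> x = \<phi> y \<longleftrightarrow> x = y"
proof -
  have add: "\<phi> (x + y) = \<phi> x + \<phi> y" for x y using embedding by (simp add: field_embedding_def)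
  show "\<phi> 1 = 1" "\<phi> (x * y) = \<phi> x * \<phi> y" "\<phi> (x + y) = \<phi> x + \<phi> y"
    using embedding by (simp_all add: field_embedding_def)
  show "\<phi> 0 = 0" using add[of 0 0] by (metis add.right_neutral add_left_imp_eq)
  show "\<phi> (x - y) = \<phi> x - \<phi> y" using add[of "x - y" y] by simp
  show "\<phi> x = \<phi> y \<longleftrightarrow> x = y" using field_embedding_inj[OF embedding] by (auto dest: injD)
qed

sublocale L: vector_space "ext_scale \<phi>"
  by (rule vector_space_ext_scale[OF embedding])

sublocale Forms: vector_space "form_scale :: 'k \<Rightarrow> ('l \<Rightarrow> 'l \<Rightarrow> 'k) \<Rightarrow> 'l \<Rightarrow> 'l \<Rightarrow> 'k"
  by (rule vector_space_form_scale)

lemma finite_extension: "finite (UNIV :: 'l set)"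
  using galois finite_of_finite_dimensional by (auto simp: finite_galois_extension_def)

lemma finite_subset_extension [simp]: "finite (S :: 'l set)"
  by (rule finite_subset[OF subset_UNIV finite_extension])

lemma card_extension: "CARD('l) = q ^ n"
  using finite_field_vector_space_card[OF L.vector_space_axioms L.subspace_UNIV finite_extension]
  unfolding card_base degree[symmetric] ext_degree_def .

lemma degree_pos: "n > 0"
proof (rule ccontr)
  assume "\<not> n > 0"
  then have "CARD('l) = 1" using card_extension by simp
  then obtain z :: 'l where "UNIV = {z}" by (metis card_1_singletonE)
  then have "(0::'l) = z" "(1::'l) = z" by blast+
  then show False by simp
qed

lemma base_ge_2: "q \<ge> 2"
proof -
  have "card {0, 1::'k} \<le> CARD('k)" by (rule card_mono) auto
  then show ?thesis by (simp add: card_base)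
qed

lemma frobenius_mem: "frobenius \<phi> \<in> galois_set \<phi>"
  using generated generate.incl[of "frobenius \<phi>" "{frobenius \<phi>}" "galois_group \<phi>"]
  by (simp add: galois_group_def)

lemma frobenius_power: "frobenius \<phi> x = x ^ q"
  by (simp add: frobenius_def card_base)

lemma power_q_add: "(x + y :: 'l) ^ q = x ^ q + y ^ q"
  and power_q_base: "\<phi> c ^ q = \<phi> c"
  and power_q_surj: "\<exists>y :: 'l. y ^ q = z"
  using frobenius_mem
  by (auto simp: galois_set_def field_embedding_def frobenius_power bij_def surj_def) metis

lemma power_q_power_add: "(x + y :: 'l) ^ (q ^ m) = x ^ (q ^ m) + y ^ (q ^ m)"
  by (induction m) (simp_all add: power_mult mult.commute[of q] power_q_add)

lemma power_q_power_base: "\<phi> c ^ (q ^ m) = \<phi> c"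
  by (induction m) (simp_all add: power_mult power_q_base)

lemma power_card: "(x :: 'l) ^ (q ^ n) = x"
proof (cases "x = 0")
  case True
  then show ?thesis using base_ge_2 by simp
next
  case False
  have "x ^ (q ^ n) = x ^ (Suc (q ^ n - 1))" using base_ge_2 by simp
  also have "\<dots> = x"
    using finite_field_unit_power[OF finite_extension False] by (simp add: card_extension)
  finally show ?thesis .
qed

lemma galois_set_comp: "f \<in> galois_set \<phi> \<Longrightarrow> g \<in> galois_set \<phi> \<Longrightarrow> f \<circ> g \<in> galois_set \<phi>"
  by (auto simp: galois_set_def field_embedding_def bij_comp)

text \<open>
  Powers of the Frobenius map are closed under composition, and its \<open>n\<close>-th power is the
  identity. So they contain the inverse of the Frobenius map, and exponents may be reduced
  modulo \<open>n\<close>.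
\<close>
lemma galois_set_power:
  assumes "\<theta> \<in> galois_set \<phi>"
  obtains i where "i < n" and "\<theta> = (\<lambda>x. x ^ (q ^ i))"
proof -
  define pw where "pw i = (\<lambda>x::'l. x ^ (q ^ i))" for i
  have pw_add: "pw i \<circ> pw j = pw (i + j)" for i j
    by (simp add: pw_def fun_eq_iff power_mult[symmetric] power_add mult.commute)
  have pw_n: "pw n = id" by (simp add: pw_def fun_eq_iff power_card)
  have pw_frob: "frobenius \<phi> = pw 1" by (simp add: pw_def fun_eq_iff frobenius_power)
  have group_inv: "inv\<^bsub>galois_group \<phi>\<^esub> (pw 1) \<in> range pw"
  proof -
    let ?G = "galois_group \<phi>"
    have one: "\<one>\<^bsub>?G\<^esub> = id" "monoid.mult ?G = (\<circ>)" "carrier ?G = galois_set \<phi>"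
      by (simp_all add: galois_group_def)
    have bij: "bij (pw 1)" using frobenius_mem by (simp add: galois_set_def pw_frob)
    have "pw 1 \<circ> pw (n - 1) = id" using pw_add[of 1 "n - 1"] pw_n degree_pos by simp
    have uniq: "h = pw (n - 1)" if "pw 1 \<circ> h = id" for h
    proof
      fix x
      have "pw 1 (h x) = pw 1 (pw (n - 1) x)"
        using that \<open>pw 1 \<circ> pw (n - 1) = id\<close> by (metis comp_apply)
      then show "h x = pw (n - 1) x" using bij by (meson bij_def injD)
    qed
    have id_mem: "id \<in> galois_set \<phi>" by (simp add: galois_set_def field_embedding_def)
    have pw_mem: "pw i \<in> galois_set \<phi>" for i
    proof (induction i)
      case 0
      then show ?case using id_mem by (simp add: pw_def id_def)
    next
      case (Suc i)
      then show ?case using pw_add[of 1 i] galois_set_comp[of "pw 1" "pw i"] frobenius_mem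
        by (simp add: pw_frob)
    qed
    have "inv\<^bsub>?G\<^esub> (pw 1) = pw (n - 1)"
      unfolding m_inv_def one
    proof (rule the_equality)
      have "pw (n - 1) \<circ> pw 1 = id" using pw_add[of "n - 1" 1] pw_n degree_pos by simp
      then show "pw (n - 1) \<in> galois_set \<phi> \<and> pw 1 \<circ> pw (n - 1) = id \<and> pw (n - 1) \<circ> pw 1 = id"
        using pw_mem \<open>pw 1 \<circ> pw (n - 1) = id\<close> by blast
    qed (use uniq in blast)
    then show ?thesis by blast
  qed
  have "\<theta> \<in> generate (galois_group \<phi>) {frobenius \<phi>}"
    using assms generated by (simp add: galois_group_def)
  then have "\<theta> \<in> range pw"
  proof (induction rule: generate.induct)
    case one
    have "\<one>\<^bsub>galois_group \<phi>\<^esub> = pw 0" by (simp add: galois_group_def pw_def fun_eq_iff)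
    then show ?case by (metis rangeI)
  next
    case (incl h)
    then show ?case using pw_frob by simp
  next
    case (inv h)
    then show ?case using group_inv pw_frob by simp
  next
    case (eng h1 h2)
    then show ?case using pw_add by (force simp: galois_group_def)
  qed
  then obtain i where i: "\<theta> = pw i" by blast
  have "pw (i + n * j) = pw i" for i j
  proof (induction j)
    case (Suc j)
    have "pw (i + n * Suc j) = pw (i + n * j) \<circ> pw n" unfolding pw_add by (simp add: ac_simps)
    then show ?case using Suc pw_n by simp
  qed simp
  from this[of "i mod n" "i div n"] have "\<theta> = pw (i mod n)" using i by simp
  then show ?thesis using that[of "i mod n"] degree_pos by (simp add: pw_def)
qed

lemma galois_set_finite: "finite (galois_set \<phi>)"
proof -
  have "galois_set \<phi> \<subseteq> (\<lambda>i x. x ^ (q ^ i)) ` {..<n}" by (blast elim: galois_set_power)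
  then show ?thesis using finite_surj by blast
qed

lemma galois_set_comp_image:
  assumes "\<rho> \<in> galois_set \<phi>"
  shows "bij_betw (\<lambda>\<theta>. \<rho> \<circ> \<theta>) (galois_set \<phi>) (galois_set \<phi>)"
    and "bij_betw (\<lambda>\<theta>. \<theta> \<circ> \<rho>) (galois_set \<phi>) (galois_set \<phi>)"
proof -
  have bij: "bij \<rho>" using assms by (simp add: galois_set_def)
  have "inj_on (\<lambda>\<theta>. \<rho> \<circ> \<theta>) (galois_set \<phi>)"
    using bij by (auto simp: inj_on_def fun_eq_iff bij_def)
  moreover have "inj_on (\<lambda>\<theta>. \<theta> \<circ> \<rho>) (galois_set \<phi>)"
  proof (rule inj_onI)
    fix f g assume "f \<circ> \<rho> = g \<circ> \<rho>"
    then show "f = g" using bij by (metis bij_betw_def surj_fun_eq)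
  qed
  moreover have "(\<lambda>\<theta>. \<rho> \<circ> \<theta>) ` galois_set \<phi> \<subseteq> galois_set \<phi>"
    "(\<lambda>\<theta>. \<theta> \<circ> \<rho>) ` galois_set \<phi> \<subseteq> galois_set \<phi>"
    using assms galois_set_comp by auto
  ultimately show "bij_betw (\<lambda>\<theta>. \<rho> \<circ> \<theta>) (galois_set \<phi>) (galois_set \<phi>)"
    "bij_betw (\<lambda>\<theta>. \<theta> \<circ> \<rho>) (galois_set \<phi>) (galois_set \<phi>)"
    using galois_set_finite by (auto simp: bij_betw_def endo_inj_surj)
qed

lemma galois_apply:
  assumes "\<theta> \<in> galois_set \<phi>"
  shows "\<theta> (x + y) = \<theta> x + \<theta> y" "\<theta> (x * y) = \<theta> x * \<theta> y" "\<theta> (\<phi> c) = \<phi> c"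
    "\<theta> 0 = 0"
proof -
  show add: "\<theta> (x + y) = \<theta> x + \<theta> y" "\<theta> (x * y) = \<theta> x * \<theta> y" "\<theta> (\<phi> c) = \<phi> c" for x y c
    using assms by (simp_all add: galois_set_def field_embedding_def)
  show "\<theta> 0 = 0" using add(3)[of 0] by (simp add: embedding_simps)
qed

lemma embedding_trace: "\<phi> (galois_trace \<phi> x) = (\<Sum>\<theta>\<in>galois_set \<phi>. \<theta> x)"
proof -
  have "\<rho> (\<Sum>\<theta>\<in>galois_set \<phi>. \<theta> x) = (\<Sum>\<theta>\<in>galois_set \<phi>. \<theta> x)"
    if \<rho>: "\<rho> \<in> galois_set \<phi>" for \<rho>
  proof -
    have "\<rho> (\<Sum>\<theta>\<in>S. \<theta> x) = (\<Sum>\<theta>\<in>S. (\<rho> \<circ> \<theta>) x)" for S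
      by (induction S rule: infinite_finite_induct) (simp_all add: galois_apply[OF \<rho>])
    then show ?thesis
      using sum.reindex_bij_betw[OF galois_set_comp_image(1)[OF \<rho>], of "\<lambda>\<theta>. \<theta> x"] by simp
  qed
  then have "(\<Sum>\<theta>\<in>galois_set \<phi>. \<theta> x) \<in> range \<phi>"
    using galois by (auto simp: finite_galois_extension_def)
  then show ?thesis unfolding galois_trace_def by (rule f_inv_into_f)
qed

lemma trace_add: "galois_trace \<phi> (x + y) = galois_trace \<phi> x + galois_trace \<phi> y"
  and trace_scale: "galois_trace \<phi> (\<phi> c * x) = c * galois_trace \<phi> x"
proof -
  have "\<phi> (galois_trace \<phi> (x + y)) = \<phi> (galois_trace \<phi> x + galois_trace \<phi> y)"
    by (simp add: embedding_trace embedding_simps galois_apply sum.distrib)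
  moreover have "\<phi> (galois_trace \<phi> (\<phi> c * x)) = \<phi> (c * galois_trace \<phi> x)"
    by (simp add: embedding_trace embedding_simps galois_apply sum_distrib_left)
  ultimately show "galois_trace \<phi> (x + y) = galois_trace \<phi> x + galois_trace \<phi> y"
    "galois_trace \<phi> (\<phi> c * x) = c * galois_trace \<phi> x"
    by (simp_all add: embedding_simps(6))
qed

lemma trace_zero: "galois_trace \<phi> 0 = 0"
  using trace_add[of 0 0] by (metis add.right_neutral add_left_imp_eq)

lemma trace_diff: "galois_trace \<phi> (x - y) = galois_trace \<phi> x - galois_trace \<phi> y"
  using trace_add[of "x - y" y] by simp

lemma trace_power_q: "galois_trace \<phi> (x ^ q) = galois_trace \<phi> x"
  using sum.reindex_bij_betw[OF galois_set_comp_image(2)[OF frobenius_mem], of "\<lambda>\<theta>. \<theta> x"]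
  unfolding embedding_simps(6)[symmetric] embedding_trace by (simp add: frobenius_power)

text \<open>
  The trace is a polynomial function: a sum of distinct monomials of degree less than \<open>q ^ n\<close>.
  Such a polynomial is nonzero and has fewer roots than the extension has elements.
\<close>
lemma trace_nonzero: "\<exists>x. galois_trace \<phi> x \<noteq> 0"
proof (rule ccontr)
  assume "\<not> (\<exists>x. galois_trace \<phi> x \<noteq> 0)"
  then have zero: "(\<Sum>\<theta>\<in>galois_set \<phi>. \<theta> x) = 0" for x
    using embedding_trace[of x] by (simp add: embedding_simps)
  have "\<forall>\<theta>\<in>galois_set \<phi>. \<exists>i. i < n \<and> \<theta> = (\<lambda>x. x ^ (q ^ i))"
    by (blast elim: galois_set_power)
  then obtain e where e: "\<And>\<theta>. \<theta> \<in> galois_set \<phi> \<Longrightarrow> e \<theta> < n \<and> \<theta> = (\<lambda>x. x ^ (q ^ e \<theta>))"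
    unfolding bchoice_iff by blast
  define p :: "'l poly" where "p = (\<Sum>\<theta>\<in>galois_set \<phi>. monom 1 (q ^ e \<theta>))"
  let ?d = "q ^ e (frobenius \<phi>)"
  have "coeff p ?d = (\<Sum>\<theta>\<in>galois_set \<phi>. if \<theta> = frobenius \<phi> then 1 else 0)"
    unfolding p_def coeff_sum
  proof (rule sum.cong)
    fix \<theta> assume "\<theta> \<in> galois_set \<phi>"
    then have "q ^ e \<theta> = ?d \<longleftrightarrow> \<theta> = frobenius \<phi>" using e frobenius_mem by metis
    then show "coeff (monom 1 (q ^ e \<theta>)) ?d = (if \<theta> = frobenius \<phi> then 1 else (0::'l))"
      by (simp add: coeff_monom)
  qed simp
  then have "coeff p ?d = 1" using galois_set_finite frobenius_mem by simp
  then have "p \<noteq> 0" by force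
  have "degree p < q ^ n"
    unfolding p_def
  proof (rule degree_sum_less)
    fix \<theta> assume "\<theta> \<in> galois_set \<phi>"
    then show "degree (monom (1::'l) (q ^ e \<theta>)) < q ^ n"
      using e base_ge_2 by (simp add: degree_monom_eq power_strict_increasing)
  qed (use base_ge_2 in simp)
  moreover have "poly p x = 0" for x
  proof -
    have "poly p x = (\<Sum>\<theta>\<in>galois_set \<phi>. \<theta> x)"
      unfolding p_def poly_sum poly_monom by (rule sum.cong) (use e in \<open>auto, metis\<close>)
    then show ?thesis using zero by simp
  qed
  then have "CARD('l) \<le> degree p" using card_poly_roots_bound[OF \<open>p \<noteq> 0\<close>] by simp
  ultimately show False by (simp add: card_extension)
qed

lemma trace_nondegenerate:
  assumes "\<And>y. galois_trace \<phi> (y * z) = 0"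
  shows "z = 0"
proof (rule ccontr)
  assume "z \<noteq> 0"
  obtain x where "galois_trace \<phi> x \<noteq> 0" using trace_nonzero by blast
  then show False using assms[of "x / z"] \<open>z \<noteq> 0\<close> by simp
qed

section \<open>The skew-forms attached to the Frobenius map\<close>

lemma form_add: "form (b + c) = form b + form c"
proof (intro ext)
  show "form (b + c) x y = (form b + form c) x y" for x y
    unfolding skew_form_def plus_fun_apply distrib_right trace_add ..
qed

lemma form_zero: "form 0 = 0"
  using form_add[of 0 0] by (metis add.right_neutral add_left_imp_eq)

lemma form_scaled: "form (\<phi> c * b) = form_scale c (form b)"
  unfolding skew_form_def form_scale_def mult.assoc trace_scale ..

lemma form_alternating: "form b \<in> Alt \<phi>"
proof -
  have vs: "vector_space ((*) :: 'k \<Rightarrow> 'k \<Rightarrow> 'k)"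
    by unfold_locales (simp_all add: algebra_simps)
  have form_eq: "form b x y = galois_trace \<phi> (b * (x * y ^ q - x ^ q * y))" for x y
    by (simp add: skew_form_def frobenius_power)
  have right: "form b x (y + z) = form b x y + form b x z"
    "form b x (ext_scale \<phi> c y) = c * form b x y" for x y z c
    unfolding form_eq trace_add[symmetric] trace_scale[symmetric] ext_scale_def
    by (simp_all add: power_q_add power_mult_distrib power_q_base algebra_simps)
  have left: "form b (x + y) z = form b x z + form b y z"
    "form b (ext_scale \<phi> c x) z = c * form b x z" for x y z c
    unfolding form_eq trace_add[symmetric] trace_scale[symmetric] ext_scale_def
    by (simp_all add: power_q_add power_mult_distrib power_q_base algebra_simps)
  have "form b x x = 0" for x by (simp add: form_eq trace_zero mult.commute)
  then show ?thesis
    unfolding Alt_def Vector_Spaces.linear_iff using vs L.vector_space_axioms left right by blast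
qed

text \<open>
  Applying the Frobenius map inside the trace of the second term moves it from \<open>x\<close> to \<open>y\<close>, so
  that both terms become multiples of \<open>y ^ q\<close>. As \<open>y\<close> varies, so does \<open>y ^ q\<close> over the whole
  extension, and nondegeneracy of the trace applies.
\<close>
lemma form_radical_eq: "form_radical (form b) = {x. b ^ q * x ^ (q\<^sup>2) = b * x}"
proof -
  have eq: "form b x y = galois_trace \<phi> (y ^ q * (b * x - b ^ q * x ^ (q\<^sup>2)))" for x y
  proof -
    have "form b x y = galois_trace \<phi> (b * x * y ^ q) - galois_trace \<phi> (b * x ^ q * y)"
      by (simp add: skew_form_def frobenius_power trace_diff[symmetric] algebra_simps)
    also have "galois_trace \<phi> (b * x ^ q * y) = galois_trace \<phi> ((b * x ^ q * y) ^ q)"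
      by (simp add: trace_power_q)
    also have "(b * x ^ q * y) ^ q = b ^ q * x ^ (q\<^sup>2) * y ^ q"
      by (simp add: power_mult_distrib power_mult[symmetric] power2_eq_square)
    finally show ?thesis by (simp add: trace_diff[symmetric] algebra_simps)
  qed
  have "(\<forall>y. form b x y = 0) \<longleftrightarrow> b * x - b ^ q * x ^ (q\<^sup>2) = 0" for x
  proof
    assume *: "\<forall>y. form b x y = 0"
    show "b * x - b ^ q * x ^ (q\<^sup>2) = 0"
    proof (rule trace_nondegenerate)
      fix z :: 'l obtain y where "y ^ q = z" using power_q_surj by blast
      then show "galois_trace \<phi> (z * (b * x - b ^ q * x ^ (q\<^sup>2))) = 0" using * eq by metis
    qed
  next
    assume "b * x - b ^ q * x ^ (q\<^sup>2) = 0"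
    then show "\<forall>y. form b x y = 0" using trace_zero by (simp add: eq)
  qed
  then show ?thesis by (auto simp: form_radical_def)
qed

lemma subspace_form_image: "L.subspace S \<Longrightarrow> Forms.subspace (form ` S)"
proof -
  assume S: "L.subspace S"
  have "0 \<in> form ` S" using L.subspace_0[OF S] form_zero by (metis imageI)
  moreover have "form a + form b \<in> form ` S" if "a \<in> S" "b \<in> S" for a b
    using L.subspace_add[OF S that] form_add[of a b] by (metis imageI)
  moreover have "form_scale c (form a) \<in> form ` S" if "a \<in> S" for a c
    using L.subspace_scale[OF S that, of c] form_scaled[of c a] by (metis ext_scale_def imageI)
  ultimately show "Forms.subspace (form ` S)" unfolding Forms.subspace_def by auto
qed


section \<open>Twisted fixed spaces and ranks\<close>

text \<open>
  One notion covers all spaces that occur. For \<open>\<epsilon> = 1\<close> and \<open>m\<close> a divisor of \<open>n\<close> it is the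
  subfield of degree \<open>m\<close>. If \<open>2 m\<close> divides \<open>n\<close> and \<open>q\<close> is odd, then for \<open>\<epsilon> = -1\<close> it is a
  complement of this subfield in the subfield of degree \<open>2 m\<close>. The radicals of the nonzero
  forms are of this kind too, with \<open>m = 2\<close> and \<open>\<epsilon>\<close> in general outside the base field.
\<close>
definition twisted_fixed :: "'l \<Rightarrow> nat \<Rightarrow> 'l set" where
  "twisted_fixed \<epsilon> m = {x. x ^ (q ^ m) = \<epsilon> * x}"

lemma subspace_twisted_fixed: "L.subspace (twisted_fixed \<epsilon> m)"
  using base_ge_2
  by (auto simp: L.subspace_def twisted_fixed_def power_q_power_add algebra_simps ext_scale_def
      power_mult_distrib power_q_power_base)

lemma twisted_fixed_power_iff:
  assumes "x \<noteq> 0"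
  shows "x \<in> twisted_fixed \<epsilon> m \<longleftrightarrow> x ^ (q ^ m - 1) = \<epsilon>"
proof -
  have "x ^ (q ^ m) = x ^ Suc (q ^ m - 1)" using base_ge_2 by simp
  then show ?thesis using assms by (simp add: twisted_fixed_def mult.commute)
qed

text \<open>
  The nonzero elements are the roots of \<open>x ^ (q ^ m - 1) = \<epsilon>\<close>. If there is one root, all are
  obtained from it by multiplication with the roots of unity of order dividing \<open>q ^ m - 1\<close>; and there
  is one precisely if \<open>\<epsilon>\<close> lies in the image of that power map, which is the kernel of the
  complementary one.
\<close>
lemma card_twisted_fixed:
  assumes e: "q ^ n - 1 = (q ^ m - 1) * e" and "\<epsilon> \<noteq> 0"
  shows "card (twisted_fixed \<epsilon> m) = (if \<epsilon> ^ e = 1 then q ^ m else 1)"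
proof -
  let ?d = "q ^ m - 1"
  have d: "CARD('l) - 1 = ?d * e" "CARD('l) - 1 = e * ?d" using e by (simp_all add: card_extension)
  have "q ^ n \<ge> 2"
    using self_le_power[of q n] base_ge_2 degree_pos by linarith
  then have "?d > 0" using e by (cases "?d = 0") auto
  have zero: "0 \<in> twisted_fixed \<epsilon> m" using base_ge_2 by (simp add: twisted_fixed_def)
  have units: "twisted_fixed \<epsilon> m = insert 0 {x. x ^ ?d = \<epsilon>}"
  proof (rule Set.set_eqI)
    fix x show "x \<in> twisted_fixed \<epsilon> m \<longleftrightarrow> x \<in> insert 0 {x. x ^ ?d = \<epsilon>}"
      using zero twisted_fixed_power_iff[of x \<epsilon> m] by (cases "x = 0") auto
  qed
  have not0: "0 \<notin> {x. x ^ ?d = \<epsilon>}" using \<open>?d > 0\<close> \<open>\<epsilon> \<noteq> 0\<close> by (auto simp: power_0_left)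
  show ?thesis
  proof (cases "\<epsilon> ^ e = 1")
    case True
    then have "\<epsilon> \<in> (\<lambda>x. x ^ ?d) ` (- {0})"
      using finite_field_roots_of_unity(2)[OF finite_extension d(2)] by blast
    then obtain z where z: "z \<noteq> 0" "z ^ ?d = \<epsilon>" by auto
    have "{x. x ^ ?d = \<epsilon>} = (\<lambda>x. z * x) ` {x. x ^ ?d = 1}"
    proof (intro equalityI subsetI)
      fix x assume "x \<in> {x. x ^ ?d = \<epsilon>}"
      then have "x = z * (x / z)" "(x / z) ^ ?d = 1" using z \<open>\<epsilon> \<noteq> 0\<close> by (simp_all add: power_divide)
      then show "x \<in> (\<lambda>x. z * x) ` {x. x ^ ?d = 1}" by blast
    qed (use z in \<open>auto simp: power_mult_distrib\<close>)
    then have "card {x. x ^ ?d = \<epsilon>} = ?d"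
      using finite_field_roots_of_unity(1)[OF finite_extension d(1)] z(1)
      by (simp add: card_image inj_on_def)
    then show ?thesis unfolding units using True not0 base_ge_2 by simp
  next
    case False
    have "\<epsilon> ^ e = 1" if "x ^ ?d = \<epsilon>" for x
    proof -
      have "x \<noteq> 0" using that not0 by blast
      then have "(x ^ ?d) ^ e = 1"
        using finite_field_unit_power[OF finite_extension \<open>x \<noteq> 0\<close>] by (simp only: d(1) power_mult)
      then show ?thesis using that by simp
    qed
    then have "{x. x ^ ?d = \<epsilon>} = {}" using False by blast
    then show ?thesis unfolding units using False by simp
  qed
qed

lemma dim_twisted_fixed:
  assumes "q ^ n - 1 = (q ^ m - 1) * e" and "\<epsilon> \<noteq> 0"
  shows "L.dim (twisted_fixed \<epsilon> m) = (if \<epsilon> ^ e = 1 then m else 0)"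
  by (rule dim_of_card[OF L.vector_space_axioms subspace_twisted_fixed])
    (simp only: card_base[symmetric] card_twisted_fixed[OF assms] split: if_split, simp)

lemma form_radical_twisted_fixed:
  assumes "b \<noteq> 0"
  shows "form_radical (form b) = twisted_fixed (b / b ^ q) 2"
  using assms by (auto simp: form_radical_eq twisted_fixed_def field_simps)

text \<open>
  The radical is the twisted fixed space for \<open>\<epsilon> = b / b ^ q\<close>, the inverse of \<open>b ^ (q - 1)\<close>. With
  \<open>e = (q ^ n - 1) / (q ^ 2 - 1)\<close> the exponent \<open>(q - 1) e\<close> is \<open>D\<close>, so \<open>\<epsilon> ^ e\<close> is the inverse
  of \<open>b ^ D\<close>.
\<close>
lemma form_rank_eq:
  assumes "even n" and D: "q ^ n - 1 = (q + 1) * D" and "b \<noteq> 0"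
  shows "form_rank \<phi> (form b) = (if b ^ D = 1 then n - 2 else n)"
proof -
  have "q ^ 2 - 1 dvd q ^ n - 1" using power_minus_one_dvd[of 2 n q] assms(1) base_ge_2 by simp
  then obtain e where e: "q ^ n - 1 = (q ^ 2 - 1) * e" by (rule dvdE)
  have "q ^ 2 - 1 = (q + 1) * (q - 1)"
    using power_double_minus_one[of q 1] by (metis mult.commute mult.right_neutral power_one_right)
  then have "(q + 1) * D = (q + 1) * ((q - 1) * e)" using e D by (simp only: mult.assoc)
  then have De: "D = (q - 1) * e" by (simp only: mult_cancel1) simp
  have "b ^ q = b * b ^ (q - 1)" using base_ge_2 by (metis gr_zeroI not_numeral_le_zero power_eq_if)
  then have "(b / b ^ q) * b ^ (q - 1) = 1" using assms(3) by simp
  then have "(b / b ^ q) ^ e * b ^ D = 1" unfolding De by (metis power_mult power_mult_distrib power_one)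
  then have "(b / b ^ q) ^ e = 1 \<longleftrightarrow> b ^ D = 1" by auto
  then show ?thesis
    unfolding form_rank_def form_radical_twisted_fixed[OF assms(3)] degree
    using dim_twisted_fixed[OF e, of "b / b ^ q"] assms(3) by simp
qed

text \<open>
  The radical of a form with \<open>b \<noteq> 0\<close> has at most \<open>q ^ 2\<close> elements, too few to be everything
  if \<open>n > 2\<close>.
\<close>
lemma inj_form:
  assumes "n > 2"
  shows "inj form"
proof (rule injI)
  fix b c assume eq: "form b = form c"
  have "form (b - c) + form c = form c" unfolding form_add[symmetric] by (simp add: eq)
  then have zero: "form (b - c) = 0" by simp
  show "b = c"
  proof (rule ccontr)
    assume "b \<noteq> c"
    define \<epsilon> where "\<epsilon> = (b - c) / (b - c) ^ q"
    have "UNIV = twisted_fixed \<epsilon> 2"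
      using form_radical_twisted_fixed[of "b - c"] \<open>b \<noteq> c\<close>
      by (auto simp: zero form_radical_def \<epsilon>_def)
    have "UNIV \<subseteq> insert 0 {x. x ^ (q ^ 2 - 1) = \<epsilon>}"
      using twisted_fixed_power_iff[of _ \<epsilon> 2] \<open>UNIV = twisted_fixed \<epsilon> 2\<close> by blast
    moreover have pos: "q ^ 2 - 1 > 0" 
      using mult_le_mono[OF base_ge_2 base_ge_2] by (simp add: power2_eq_square)
    ultimately have "CARD('l) \<le> card (insert 0 {x. x ^ (q ^ 2 - 1) = \<epsilon>})"
      by (intro card_mono) auto
    also have "\<dots> \<le> Suc (q ^ 2 - 1)"
      using card_insert_le_m1 card_power_eq_le(2)[OF pos, of \<epsilon>] by (simp add: card_insert_if)
    finally have "q ^ n \<le> q ^ 2" using pos by (simp add: card_extension)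
    then show False using assms base_ge_2 by (simp add: power_le_imp_le_exp leD)
  qed
qed

lemma dim_form_image:
  assumes "n > 2" and "L.subspace S" and "card S = q ^ d"
  shows "form_dim (form ` S) = d"
proof (rule dim_of_card[OF vector_space_form_scale subspace_form_image[OF assms(2)]])
  have "inj_on form S" using inj_form[OF assms(1)] inj_on_subset by blast
  then show "card (form ` S) = CARD('k) ^ d" using assms(3) by (simp add: card_image card_base)
qed

lemma rank_subspace_form_image:
  assumes "L.subspace S" and "\<And>b. b \<in> S \<Longrightarrow> b \<noteq> 0 \<Longrightarrow> form_rank \<phi> (form b) = r"
  shows "rank_subspace \<phi> r (form ` S)"
  unfolding rank_subspace_def
  using subspace_form_image[OF assms(1)] form_alternating form_zero assms(2) by force

section \<open>Splitting the extension along its tower of subfields\<close>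

lemma power_q_power_diff: "(x - y :: 'l) ^ (q ^ m) = x ^ (q ^ m) - y ^ (q ^ m)"
  using power_q_power_add[of "x - y" y m] by simp

text \<open>
  If \<open>2 = 0\<close>, then \<open>x ^ 2 = 1\<close> would have the single solution \<open>1\<close>, although the group of units has
  even order.
\<close>
lemma two_nonzero:
  assumes "odd q"
  shows "(2 :: 'l) \<noteq> 0"
proof
  assume two: "(2 :: 'l) = 0"
  have "even (CARD('l) - 1)" using assms by (simp add: card_extension)
  then obtain e where "CARD('l) - 1 = 2 * e" by (rule evenE)
  then have "card {x::'l. x ^ 2 = 1} = 2" using finite_field_roots_of_unity(1)[OF finite_extension] by blast
  moreover have "x = 1" if "x ^ 2 = 1" for x :: 'l
  proof -
    have "(x - 1) ^ 2 = x ^ 2 - 2 * x + 1" by (simp add: power2_eq_square algebra_simps)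
    then show ?thesis using that two by simp
  qed
  then have "{x::'l. x ^ 2 = 1} = {1}" by auto
  ultimately show False by simp
qed

text \<open>
  The usual splitting under an involution: \<open>x\<close> is the sum of its symmetric part
  \<open>(x + x ^ (q ^ m)) / 2\<close> and its antisymmetric part \<open>(x - x ^ (q ^ m)) / 2\<close>.
\<close>
lemma twisted_fixed_split:
  assumes "odd q"
  shows "twisted_fixed 1 (2 * m) =
    {x + y | x y. x \<in> twisted_fixed 1 m \<and> y \<in> twisted_fixed (- 1) m}"
proof (intro equalityI subsetI)
  fix x assume "x \<in> twisted_fixed 1 (2 * m)"
  then have x: "(x ^ (q ^ m)) ^ (q ^ m) = x"
    by (simp add: twisted_fixed_def power_mult[symmetric] power_add[symmetric] mult_2)
  have two: "(2 :: 'l) ^ (q ^ m) = 2"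
    using power_q_power_base[of "1 + 1" m] embedding_simps(1,2) by (metis one_add_one)
  have "x = (x + x ^ (q ^ m)) / 2 + (x - x ^ (q ^ m)) / 2"
    using two_nonzero[OF assms] by (simp add: field_simps)
  moreover have "(x + x ^ (q ^ m)) / 2 \<in> twisted_fixed 1 m"
    unfolding twisted_fixed_def mem_Collect_eq power_divide power_q_power_add x two
    by (simp add: add.commute)
  moreover have "(x - x ^ (q ^ m)) / 2 \<in> twisted_fixed (- 1) m"
    unfolding twisted_fixed_def mem_Collect_eq power_divide power_q_power_diff x two
    by (simp add: minus_divide_left)
  ultimately show "x \<in> {x + y | x y. x \<in> twisted_fixed 1 m \<and> y \<in> twisted_fixed (- 1) m}" by blast
next
  fix z assume "z \<in> {x + y | x y. x \<in> twisted_fixed 1 m \<and> y \<in> twisted_fixed (- 1) m}"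
  then obtain x y where z: "z = x + y" "x ^ (q ^ m) = x" "y ^ (q ^ m) = - y"
    by (auto simp: twisted_fixed_def)
  have "(- y) ^ (q ^ m) = y" using power_q_power_diff[of 0 y m] z(3) base_ge_2 by simp
  then have "((x + y) ^ (q ^ m)) ^ (q ^ m) = x + y"
    using z power_q_power_diff[of x y m] by (simp add: power_q_power_add)
  then show "z \<in> twisted_fixed 1 (2 * m)"
    by (simp add: z(1) twisted_fixed_def power_mult[symmetric] power_add[symmetric] mult_2)
qed

lemma twisted_fixed_disjoint:
  assumes "odd q"
  shows "twisted_fixed 1 m \<inter> twisted_fixed (- 1) m \<subseteq> {0}"
proof -
  have "x = 0" if "x = - x" for x :: 'l
  proof -
    have "2 * x = 0" using that by (metis add.right_inverse mult_2)
    then show ?thesis using two_nonzero[OF assms] by simp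
  qed
  then show ?thesis
    unfolding twisted_fixed_def by (intro subsetI) (metis (mono_tags) IntE mem_Collect_eq
      mult_1 mult_minus1 singletonI)
qed

lemma form_image_sum:
  "form ` {x + y | x y. x \<in> A \<and> y \<in> B} = {u + v | u v. u \<in> form ` A \<and> v \<in> form ` B}"
proof (intro equalityI subsetI)
  fix u assume "u \<in> form ` {x + y | x y. x \<in> A \<and> y \<in> B}"
  then show "u \<in> {u + v | u v. u \<in> form ` A \<and> v \<in> form ` B}" using form_add by blast
next
  fix u assume "u \<in> {u + v | u v. u \<in> form ` A \<and> v \<in> form ` B}"
  then show "u \<in> form ` {x + y | x y. x \<in> A \<and> y \<in> B}"
    using form_add[symmetric] by blast
qed

lemma direct_sum_twisted_fixed:
  assumes "odd q" and n: "n = 2 ^ \<alpha> * k" and "\<alpha> \<ge> 2" and "n > 2"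
  shows "direct_sum form_scale ({1..2} <+> {1..\<alpha> - 1})
    (case_sum (\<lambda>j::nat. if j = 1 then form ` twisted_fixed 1 k else form ` twisted_fixed (- 1) k)
      (\<lambda>i. form ` twisted_fixed (- 1) (n div 2 ^ i)))
    (skew_form_space \<phi> (frobenius \<phi>))"
proof -
  define S where "S i = form ` twisted_fixed 1 (n div 2 ^ i)" for i
  define T where "T i = form ` twisted_fixed (- 1) (n div 2 ^ i)" for i
  have half: "n div 2 ^ i = 2 * (n div 2 ^ Suc i)" if "i < \<alpha>" for i
  proof -
    from less_imp_Suc_add[OF that] obtain j where "\<alpha> = Suc (i + j)" by blast
    then have split: "n = 2 ^ i * (2 * (2 ^ j * k))" "n = 2 ^ Suc i * (2 ^ j * k)"
      unfolding n by (simp_all add: power_add)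
    have "n div 2 ^ i = 2 * (2 ^ j * k)"
      unfolding split(1) by (rule nonzero_mult_div_cancel_left) simp
    moreover have "n div 2 ^ Suc i = 2 ^ j * k"
      unfolding split(2) by (rule nonzero_mult_div_cancel_left) simp
    ultimately show ?thesis by simp
  qed
  have "direct_sum form_scale ({1..2} <+> {1..\<alpha> - 1})
      (case_sum (\<lambda>j::nat. if j = 1 then S \<alpha> else T \<alpha>) T) (S 0)"
  proof (rule direct_sum_of_chain[OF vector_space_form_scale])
    fix i assume i: "i < \<alpha>"
    show "S i = {x + y | x y. x \<in> S (Suc i) \<and> y \<in> T (Suc i)}"
      unfolding S_def T_def half[OF i] twisted_fixed_split[OF assms(1)] form_image_sum ..
    show "S (Suc i) \<inter> T (Suc i) \<subseteq> {0}"
    proof -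
      have "S (Suc i) \<inter> T (Suc i) \<subseteq> form ` {0}"
        unfolding S_def T_def image_Int[OF inj_form[OF assms(4)], symmetric]
        by (intro image_mono twisted_fixed_disjoint[OF assms(1)])
      then show ?thesis by (simp add: form_zero)
    qed
  qed (use assms(3) in \<open>auto simp: S_def T_def intro: subspace_form_image subspace_twisted_fixed\<close>)
  moreover have "S \<alpha> = form ` twisted_fixed 1 k" "T \<alpha> = form ` twisted_fixed (- 1) k"
    by (simp_all add: S_def T_def n)
  moreover have "T = (\<lambda>i. form ` twisted_fixed (- 1) (n div 2 ^ i))" by (simp add: T_def fun_eq_iff)
  moreover have "S 0 = skew_form_space \<phi> (frobenius \<phi>)"
    by (auto simp: S_def twisted_fixed_def power_card skew_form_space_def)
  ultimately show ?thesis by metis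
qed

text \<open>
  The complementary exponent contains the factor \<open>q ^ m + 1\<close>, which is even; hence it kills
  \<open>-1\<close> as well as \<open>1\<close>.
\<close>
lemma card_twisted_fixed_pm:
  assumes "odd q" and "2 * m dvd n" and "\<epsilon> = 1 \<or> \<epsilon> = - 1"
  shows "card (twisted_fixed \<epsilon> m) = q ^ m"
proof -
  obtain e where "q ^ n - 1 = (q ^ (2 * m) - 1) * e"
    using power_minus_one_dvd[OF assms(2), of q] base_ge_2 by (auto elim: dvdE)
  then have e: "q ^ n - 1 = (q ^ m - 1) * ((q ^ m + 1) * e)"
    unfolding power_double_minus_one by (simp only: mult.assoc)
  have "\<epsilon> ^ ((q ^ m + 1) * e) = 1" "\<epsilon> \<noteq> 0" using assms(1,3) by auto
  then show ?thesis using card_twisted_fixed[OF e, of \<epsilon>] by simp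
qed

section \<open>Which eigenspaces consist of powers of exponent \<open>q + 1\<close>\<close>

text \<open>
  Raising \<open>b\<close> to \<open>(q ^ n - 1) / 2 ^ i\<close> gives an odd power of \<open>-1\<close>. But this exponent is a
  multiple of \<open>D = (q ^ n - 1) / (2 ^ a l)\<close> because \<open>i \<le> a\<close>.
\<close>
lemma anti_fixed_not_power:
  assumes "odd q" and D: "q ^ n - 1 = (q + 1) * D" and q: "q + 1 = 2 ^ a * l"
    and n: "n = 2 ^ i * m" and "even m" and "i \<le> a"
    and b: "b \<in> twisted_fixed (- 1) m" "b \<noteq> 0"
  shows "b ^ D \<noteq> 1"
proof
  assume "b ^ D = 1"
  obtain u where u: "odd u" "q ^ n - 1 = 2 ^ i * u * (q ^ m - 1)"
    using two_adic_power_minus_one[OF assms(1,5)] unfolding n by blast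
  have "2 ^ i * (u * (q ^ m - 1)) = 2 ^ i * (2 ^ (a - i) * l * D)"
  proof -
    have "(2::nat) ^ a = 2 ^ i * 2 ^ (a - i)" using assms(6) by (simp add: power_add[symmetric])
    then show ?thesis using D u(2) unfolding q by (simp only: mult.assoc)
  qed
  then have "(q ^ m - 1) * u = D * (2 ^ (a - i) * l)" by (simp add: ac_simps)
  then have "(b ^ (q ^ m - 1)) ^ u = (b ^ D) ^ (2 ^ (a - i) * l)" by (metis power_mult)
  then have "(- 1 :: 'l) = 1"
    using \<open>b ^ D = 1\<close> b u(1) twisted_fixed_power_iff[OF b(2)] by simp
  then have "(2 :: 'l) = 0" by (metis add.right_inverse one_add_one)
  then show False using two_nonzero[OF assms(1)] by simp
qed

text \<open>
  Here \<open>D = (q ^ n - 1) / 2 ^ a\<close>, and since \<open>a < i\<close> a factor \<open>2\<close> is left over: \<open>D\<close> is an even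
  multiple of the exponent that sends \<open>b\<close> to \<open>-1\<close>.
\<close>
lemma anti_fixed_power:
  assumes "odd q" and D: "q ^ n - 1 = (q + 1) * D" and q: "q + 1 = 2 ^ a"
    and n: "n = 2 ^ i * m" and "even m" and "a < i"
    and b: "b \<in> twisted_fixed (- 1) m" "b \<noteq> 0"
  shows "b ^ D = 1"
proof -
  obtain u where u: "odd u" "q ^ n - 1 = 2 ^ i * u * (q ^ m - 1)"
    using two_adic_power_minus_one[OF assms(1,5)] unfolding n by blast
  have "2 ^ a * D = 2 ^ a * ((q ^ m - 1) * (2 ^ (i - a) * u))"
  proof -
    have "(2::nat) ^ i = 2 ^ a * 2 ^ (i - a)" using assms(6) by (simp add: power_add[symmetric])
    then show ?thesis using D u(2) unfolding q by (simp add: ac_simps)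
  qed
  then have "D = (q ^ m - 1) * (2 ^ (i - a) * u)" by simp
  then have "b ^ D = (b ^ (q ^ m - 1)) ^ (2 ^ (i - a) * u)" by (metis power_mult)
  moreover have "even (2 ^ (i - a) * u)" using assms(6) by simp
  ultimately show ?thesis using b twisted_fixed_power_iff[OF b(2)] by simp
qed

text \<open>
  From \<open>q ^ (2 k) - 1 = (q ^ k - 1) (q ^ k + 1)\<close>, the factor \<open>q + 1\<close> is absorbed by
  \<open>q ^ k + 1\<close>, and the factor \<open>2 ^ (\<alpha> - 1)\<close> that remains is even because \<open>\<alpha> \<ge> 2\<close>. So \<open>D\<close>
  is an even multiple of \<open>q ^ k - 1\<close>.
\<close>
lemma odd_twisted_fixed_power:
  assumes "odd q" and D: "q ^ n - 1 = (q + 1) * D"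
    and n: "n = 2 ^ \<alpha> * k" and "odd k" and "\<alpha> \<ge> 2"
    and \<epsilon>: "\<epsilon> = 1 \<or> \<epsilon> = - 1" and b: "b \<in> twisted_fixed \<epsilon> k" "b \<noteq> 0"
  shows "b ^ D = 1"
proof -
  have n2: "n = 2 ^ (\<alpha> - 1) * (2 * k)"
    using assms(5) n by (metis Suc_1 Suc_le_D diff_Suc_1 mult.assoc mult.commute power_Suc)
  obtain u where u: "q ^ n - 1 = 2 ^ (\<alpha> - 1) * u * (q ^ (2 * k) - 1)"
    using two_adic_power_minus_one[OF assms(1), of "2 * k" "\<alpha> - 1"] unfolding n2 by auto
  obtain w where w: "q ^ k + 1 = (q + 1) * w"
    using Suc_base_dvd_power_odd[OF assms(4), of q] base_ge_2 by (auto elim: dvdE)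
  have "(q + 1) * D = (q + 1) * ((q ^ k - 1) * (2 ^ (\<alpha> - 1) * u * w))"
    using u unfolding D power_double_minus_one w by (simp only: ac_simps)
  then have "D = (q ^ k - 1) * (2 ^ (\<alpha> - 1) * u * w)" by (simp only: mult_cancel1) simp
  then have "b ^ D = (b ^ (q ^ k - 1)) ^ (2 ^ (\<alpha> - 1) * u * w)" by (metis power_mult)
  moreover have "even (2 ^ (\<alpha> - 1) * u * w)" using assms(5) by simp
  ultimately show ?thesis using b twisted_fixed_power_iff[OF b(2)] \<epsilon> by auto
qed

end

section \<open>The decomposition\<close>

theorem theoremC:
  fixes \<phi> :: "'k::{field,finite} \<Rightarrow> 'l::field"
    and q a l n \<alpha> k :: nat
    and A1 :: "('l \<Rightarrow> 'l \<Rightarrow> 'k) set"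
  assumes "q = CARD('k)"
    and "\<not> (\<exists>x::'k. x ^ 2 = - 1)"
    and "q + 1 = 2 ^ a * l" and "odd l" and "a \<ge> 1"
    and "n = 2 ^ \<alpha> * k" and "odd k" and "\<alpha> \<ge> 2"
    and "finite_galois_extension \<phi>"
    and "ext_degree \<phi> = n"
    and "carrier (galois_group \<phi>) = generate (galois_group \<phi>) {frobenius \<phi>}"
    and "A1 = skew_form_space \<phi> (frobenius \<phi>)"
  shows "(\<alpha> \<le> a + 1 \<longrightarrow>
           (\<exists>(V :: nat \<Rightarrow> ('l \<Rightarrow> 'l \<Rightarrow> 'k) set) (E :: nat \<Rightarrow> ('l \<Rightarrow> 'l \<Rightarrow> 'k) set).
              direct_sum form_scale ({1..2} <+> {1..\<alpha> - 1}) (case_sum V E) A1 \<and>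
              (\<forall>i\<in>{1..\<alpha> - 1}. rank_subspace \<phi> n (E i) \<and> form_dim (E i) = n div 2 ^ i) \<and>
              (\<forall>j\<in>{1..2}. rank_subspace \<phi> (n - 2) (V j) \<and> form_dim (V j) = k)))
       \<and> (\<alpha> > a + 1 \<and> l = 1 \<longrightarrow>
           (\<exists>(V :: nat \<Rightarrow> ('l \<Rightarrow> 'l \<Rightarrow> 'k) set) (E :: nat \<Rightarrow> ('l \<Rightarrow> 'l \<Rightarrow> 'k) set).
              direct_sum form_scale ({1..2} <+> {1..\<alpha> - 1}) (case_sum V E) A1 \<and>
              (\<forall>i\<in>{1..a}. rank_subspace \<phi> n (E i) \<and> form_dim (E i) = n div 2 ^ i) \<and>
              (\<forall>i\<in>{a + 1..\<alpha> - 1}. rank_subspace \<phi> (n - 2) (E i) \<and> form_dim (E i) = n div 2 ^ i) \<and>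
              (\<forall>j\<in>{1..2}. rank_subspace \<phi> (n - 2) (V j) \<and> form_dim (V j) = k)))"
proof -
  interpret frobenius_extension \<phi> q n
    by unfold_locales (fact assms)+
  define V where "V = (\<lambda>j::nat.
    if j = 1 then form ` twisted_fixed 1 k else form ` twisted_fixed (- 1) k)"
  define E where "E = (\<lambda>i. form ` twisted_fixed (- 1) (n div 2 ^ i))"
  have "even (q + 1)" using assms(3,5) by simp
  then have odd_q: "odd q" by simp
  have "4 dvd n"
    using assms(6,8) le_imp_power_dvd[of 2 \<alpha> "2::nat"] by (simp add: dvd_mult2)
  then have n: "even n" "n > 2" using degree_pos by (auto dest: dvd_imp_le)
  have "q + 1 dvd q ^ n - 1"
    using Suc_base_dvd_square power_minus_one_dvd[of 2 n q] n(1) base_ge_2 by (auto intro: dvd_trans)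
  then obtain D where D: "q ^ n - 1 = (q + 1) * D" by (rule dvdE)
  note rank = form_rank_eq[OF n(1) D]
  have sum: "direct_sum form_scale ({1..2} <+> {1..\<alpha> - 1}) (case_sum V E) A1"
    using direct_sum_twisted_fixed[OF odd_q assms(6,8) n(2)] by (simp add: V_def E_def assms(12))
  have V: "rank_subspace \<phi> (n - 2) (V j) \<and> form_dim (V j) = k" for j
  proof -
    define \<epsilon> :: 'l where "\<epsilon> = (if j = 1 then 1 else - 1)"
    have \<epsilon>: "\<epsilon> = 1 \<or> \<epsilon> = - 1" "V j = form ` twisted_fixed \<epsilon> k" by (simp_all add: \<epsilon>_def V_def)
    have "2 * k dvd n" using assms(6,8) le_imp_power_dvd[of 1 \<alpha> "2::nat"] by (simp add: mult_dvd_mono)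
    then show ?thesis unfolding \<epsilon>(2)
      using odd_twisted_fixed_power[OF odd_q D assms(6-8) \<epsilon>(1)] rank
        card_twisted_fixed_pm[OF odd_q _ \<epsilon>(1)]
      by (auto intro!: rank_subspace_form_image dim_form_image n(2) subspace_twisted_fixed)
  qed
  have half: "n = 2 ^ i * (n div 2 ^ i) \<and> even (n div 2 ^ i) \<and> 2 * (n div 2 ^ i) dvd n"
    if "i \<in> {1..\<alpha> - 1}" for i
  proof -
    have "i < \<alpha>" using that by auto
    from less_imp_Suc_add[OF this] obtain j where "\<alpha> = Suc (i + j)" by blast
    then have "n = 2 ^ i * (2 * (2 ^ j * k))" by (simp add: assms(6) power_add)
    moreover from this have "n div 2 ^ i = 2 * (2 ^ j * k)" by simp
    moreover have "2 * (n div 2 ^ i) dvd 2 ^ i * (n div 2 ^ i)"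
      using that le_imp_power_dvd[of 1 i "2::nat"] by (intro mult_dvd_mono) auto
    ultimately show ?thesis by simp
  qed
  have E_dim: "form_dim (E i) = n div 2 ^ i" if "i \<in> {1..\<alpha> - 1}" for i
    unfolding E_def using half[OF that] card_twisted_fixed_pm[OF odd_q]
    by (intro dim_form_image n(2) subspace_twisted_fixed) simp
  have E_nondegenerate: "rank_subspace \<phi> n (E i)" if i: "i \<in> {1..\<alpha> - 1}" "i \<le> a" for i
    unfolding E_def
  proof (rule rank_subspace_form_image[OF subspace_twisted_fixed])
    fix b assume b: "b \<in> twisted_fixed (- 1) (n div 2 ^ i)" "b \<noteq> 0"
    have "b ^ D \<noteq> 1"
      using half[OF i(1)] by (intro anti_fixed_not_power[OF odd_q D assms(3) _ _ i(2) b]) auto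
    then show "form_rank \<phi> (form b) = n" using rank[OF b(2)] by simp
  qed
  have E_degenerate: "rank_subspace \<phi> (n - 2) (E i)"
    if i: "i \<in> {1..\<alpha> - 1}" "a < i" "l = 1" for i
    unfolding E_def
  proof (rule rank_subspace_form_image[OF subspace_twisted_fixed])
    fix b assume b: "b \<in> twisted_fixed (- 1) (n div 2 ^ i)" "b \<noteq> 0"
    have "q + 1 = 2 ^ a" using assms(3) i(3) by simp
    then have "b ^ D = 1"
      using half[OF i(1)] by (intro anti_fixed_power[OF odd_q D _ _ _ i(2) b]) auto
    then show "form_rank \<phi> (form b) = n - 2" using rank[OF b(2)] by simp
  qed
  show ?thesis
  proof (intro conjI impI)
    assume "\<alpha> \<le> a + 1"
    then have "i \<le> a" if "i \<in> {1..\<alpha> - 1}" for i using that by auto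
    then show "\<exists>V E. direct_sum form_scale ({1..2} <+> {1..\<alpha> - 1}) (case_sum V E) A1 \<and>
        (\<forall>i\<in>{1..\<alpha> - 1}. rank_subspace \<phi> n (E i) \<and> form_dim (E i) = n div 2 ^ i) \<and>
        (\<forall>j\<in>{1..2::nat}. rank_subspace \<phi> (n - 2) (V j) \<and> form_dim (V j) = k)"
      using sum V E_dim E_nondegenerate by blast
  next
    assume *: "a + 1 < \<alpha> \<and> l = 1"
    have low: "rank_subspace \<phi> n (E i) \<and> form_dim (E i) = n div 2 ^ i" if "i \<in> {1..a}" for i
    proof -
      have "i \<in> {1..\<alpha> - 1}" "i \<le> a" using that * by auto
      then show ?thesis using E_dim E_nondegenerate by blast
    qed
    have high: "rank_subspace \<phi> (n - 2) (E i) \<and> form_dim (E i) = n div 2 ^ i"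
      if "i \<in> {a + 1..\<alpha> - 1}" for i
    proof -
      have "i \<in> {1..\<alpha> - 1}" "a < i" using that by auto
      then show ?thesis using E_dim E_degenerate * by blast
    qed
    show "\<exists>V E. direct_sum form_scale ({1..2} <+> {1..\<alpha> - 1}) (case_sum V E) A1 \<and>
        (\<forall>i\<in>{1..a}. rank_subspace \<phi> n (E i) \<and> form_dim (E i) = n div 2 ^ i) \<and>
        (\<forall>i\<in>{a + 1..\<alpha> - 1}. rank_subspace \<phi> (n - 2) (E i) \<and>
          form_dim (E i) = n div 2 ^ i) \<and>
        (\<forall>j\<in>{1..2::nat}. rank_subspace \<phi> (n - 2) (V j) \<and> form_dim (V j) = k)"
      using sum V low high by blast
  qed
qed

end
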